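(* Let $$\mathcal{A}=\begin{bmatrix}A+B_2K_2-L_1H_1 & -B_2K_2\\ -B_1K_1 & A+B_1K_1-L_2H_2\end{bmatrix}.$$ If the observer gains $L_1,L_2$ are chosen such that $\mathcal{A}$ is stable, then the observers $\hat x_1,\hat x_2$ are stable under the controllers $u_i^\star(k)=K_i\hat x_i(k)$, $i=1,2$, in the sense that $$\lim_{k\to\infty}\|\hat x_i(k)-x(k)\|=0,\qquad i=1,2,$$ for all initial values $x(0),\hat x_1(0),\hat x_2(0)\in\mathbb{R}^n$. Moreover, if in addition $(A,B)$ is stabilizable and $(A,Q)$ is observable, then the closed-loop system $x(k+1)=Ax(k)+B_1u_1^\star(k)+B_2u_2^\star(k)$ is stable, i.e. $\lim_{k\to\infty}x(k)=0$ for all initial values $x(0),\hat x_1(0),\hat x_2(0)\in\mathbb{R}^n$.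
   Context: Let $A\in\mathbb{R}^{n\times n}$, $B_i\in\mathbb{R}^{n\times m_i}$, $H_i\in\mathbb{R}^{s_i\times n}$ ($i=1,2$) be constant real matrices, $B=[B_1\ \ B_2]$. The system is $$x(k+1)=Ax(k)+B_1u_1(k)+B_2u_2(k),\qquad y_i(k)=H_ix(k),\quad i=1,2,\quad k\ge0.$$ Let $Q\in\mathbb{R}^{n\times n}$ be symmetric positive semi-definite, $R_i\in\mathbb{R}^{m_i\times m_i}$ symmetric positive definite, $R=\mathrm{diag}(R_1,R_2)$. Let $P$ be a symmetric positive semi-definite solution of the algebraic Riccati equation $$P=A'PA+Q-A'PB(R+B'PB)^{-1}B'PA,$$ and let $K=-(R+B'PB)^{-1}B'PA$, $K_1=[I\ \ 0]K$ (the first $m_1$ rows of $K$), $K_2=[0\ \ I]K$ (the last $m_2$ rows of $K$). Here $'$ denotes transpose and $\|\cdot\|$ the Euclidean norm. With private input and measurement information, the system is driven by $u_i=u_i^\star$, $u_i^\star(k)=K_i\hat x_i(k)$, where the observers satisfy $$\hat x_1(k+1)=A\hat x_1(k)+B_1u_1^\star(k)+B_2K_2\hat x_1(k)+L_1[y_1(k)-H_1\hat x_1(k)],$$ $$\hat x_2(k+1)=A\hat x_2(k)+B_1K_1\hat x_2(k)+B_2u_2^\star(k)+L_2[y_2(k)-H_2\hat x_2(k)],$$ with gains $L_i\in\mathbb{R}^{n\times s_i}$. A square matrix is stable if all its eigenvalues lie in the open unit disc. *)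

theory Defs
  imports "HOL-Analysis.Analysis"
begin

definition sym_pos_semidef :: "real^'n^'n \<Rightarrow> bool" where
  "sym_pos_semidef M \<longleftrightarrow> transpose M = M \<and> (\<forall>x. 0 \<le> x \<bullet> (M *v x))"

definition sym_pos_def :: "real^'n^'n \<Rightarrow> bool" where
  "sym_pos_def M \<longleftrightarrow> transpose M = M \<and> (\<forall>x. x \<noteq> 0 \<longrightarrow> 0 < x \<bullet> (M *v x))"

(* Block matrices are indexed by sum types: Inl is the first block, Inr the second.
   Recall that real^'c^'r is the type of matrices with rows 'r and columns 'c. *)

definition block_matrix ::
  "'a^'c1^'r1 \<Rightarrow> 'a^'c2^'r1 \<Rightarrow> 'a^'c1^'r2 \<Rightarrow> 'a^'c2^'r2 \<Rightarrow> 'a^('c1 + 'c2)^('r1 + 'r2)" where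
  "block_matrix M11 M12 M21 M22 = (\<chi> i j.
     case i of
       Inl i1 \<Rightarrow> (case j of Inl j1 \<Rightarrow> M11 $ i1 $ j1 | Inr j2 \<Rightarrow> M12 $ i1 $ j2)
     | Inr i2 \<Rightarrow> (case j of Inl j1 \<Rightarrow> M21 $ i2 $ j1 | Inr j2 \<Rightarrow> M22 $ i2 $ j2))"

definition block_row :: "'a^'c1^'r \<Rightarrow> 'a^'c2^'r \<Rightarrow> 'a^('c1 + 'c2)^'r" where
  "block_row M1 M2 = (\<chi> i j. case j of Inl j1 \<Rightarrow> M1 $ i $ j1 | Inr j2 \<Rightarrow> M2 $ i $ j2)"

definition block_diag :: "'a::zero^'c1^'r1 \<Rightarrow> 'a^'c2^'r2 \<Rightarrow> 'a^('c1 + 'c2)^('r1 + 'r2)" where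
  "block_diag M1 M2 = block_matrix M1 0 0 M2"

definition first_rows :: "'a^'c^('r1::finite + 'r2::finite) \<Rightarrow> 'a^'c^'r1" where
  "first_rows M = (\<chi> i. M $ Inl i)"

definition last_rows :: "'a^'c^('r1::finite + 'r2::finite) \<Rightarrow> 'a^'c^'r2" where
  "last_rows M = (\<chi> i. M $ Inr i)"

(* The eigenvalues of a real matrix are the complex ones, hence complex eigenvectors. *)

definition complex_eigenvalue :: "real^'n^'n \<Rightarrow> complex \<Rightarrow> bool" where
  "complex_eigenvalue M \<mu> \<longleftrightarrow>
     (\<exists>v :: complex^'n. v \<noteq> 0 \<and> map_matrix complex_of_real M *v v = \<mu> *s v)"

definition stable_matrix :: "real^'n^'n \<Rightarrow> bool" where
  "stable_matrix M \<longleftrightarrow> (\<forall>\<mu>. complex_eigenvalue M \<mu> \<longrightarrow> norm \<mu> < 1)"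

definition stabilizable :: "real^'n^'n \<Rightarrow> real^'m^'n \<Rightarrow> bool" where
  "stabilizable A B \<longleftrightarrow> (\<exists>F :: real^'n^'m. stable_matrix (A + B ** F))"

(* The initial state of x(k+1) = A x(k) is determined by finitely many of the
   outputs C x(k) = C A^k x(0). *)

definition observable :: "real^'n^'n \<Rightarrow> real^'n^'p \<Rightarrow> bool" where
  "observable A C \<longleftrightarrow>
     (\<exists>N. \<forall>x0 z0. (\<forall>k\<le>N. C *v (((*v) A ^^ k) x0) = C *v (((*v) A ^^ k) z0)) \<longrightarrow> x0 = z0)"

(* The matrix inverted below is positive definite when R is positive definite and
   P positive semi-definite, so matrix_inv is then the true inverse. *)

definition riccati_equation ::
  "real^'n^'n \<Rightarrow> real^'m^'n \<Rightarrow> real^'n^'n \<Rightarrow> real^'m^'m \<Rightarrow> real^'n^'n \<Rightarrow> bool" where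
  "riccati_equation A B Q R P \<longleftrightarrow>
     P = transpose A ** P ** A + Q
         - transpose A ** P ** B ** matrix_inv (R + transpose B ** P ** B) ** transpose B ** P ** A"

definition riccati_gain ::
  "real^'n^'n \<Rightarrow> real^'m^'n \<Rightarrow> real^'m^'m \<Rightarrow> real^'n^'n \<Rightarrow> real^'n^'m" where
  "riccati_gain A B R P = - (matrix_inv (R + transpose B ** P ** B) ** transpose B ** P ** A)"

definition observer_closed_loop ::
  "real^'n^'n \<Rightarrow> real^'m1^'n \<Rightarrow> real^'m2^'n \<Rightarrow> real^'n^'s1 \<Rightarrow> real^'n^'s2 \<Rightarrow>
   real^'n^'m1 \<Rightarrow> real^'n^'m2 \<Rightarrow> real^'s1^'n \<Rightarrow> real^'s2^'n \<Rightarrow>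
   (nat \<Rightarrow> real^'n) \<Rightarrow> (nat \<Rightarrow> real^'n) \<Rightarrow> (nat \<Rightarrow> real^'n) \<Rightarrow> bool" where
  "observer_closed_loop A B1 B2 H1 H2 K1 K2 L1 L2 x xh1 xh2 \<longleftrightarrow>
     (let u1 = (\<lambda>k. K1 *v xh1 k); u2 = (\<lambda>k. K2 *v xh2 k);
          y1 = (\<lambda>k. H1 *v x k); y2 = (\<lambda>k. H2 *v x k)
      in \<forall>k.
        x (k + 1) = A *v x k + B1 *v u1 k + B2 *v u2 k \<and>
        xh1 (k + 1) = A *v xh1 k + B1 *v u1 k + B2 *v (K2 *v xh1 k) + L1 *v (y1 k - H1 *v xh1 k) \<and>
        xh2 (k + 1) = A *v xh2 k + B1 *v (K1 *v xh2 k) + B2 *v u2 k + L2 *v (y2 k - H2 *v xh2 k))"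

end

theory Submission
  imports Defs "HOL-Computational_Algebra.Fundamental_Theorem_Algebra"
begin

text \<open>
  The estimation errors \<open>e\<^sub>i = xh\<^sub>i - x\<close> do not feel the plant: substituting the controls
  into the three recursions and using \<open>xh1 - xh2 = e\<^sub>1 - e\<^sub>2\<close>, all terms without an error
  cancel, and the stacked error obeys the autonomous recursion \<open>e(k+1) = M e(k)\<close> with exactly
  the block matrix \<open>M\<close> that is assumed stable (\<open>observer_errors_tendsto_0\<close>). So the first
  claim is the fact that a matrix whose eigenvalues lie in the open unit disc has powers tending
  to 0 (\<open>stable_matrix_powers_tendsto_0\<close>). This is shown one vector at a time, without a normal
  form: each vector is annihilated by a nonzero polynomial in the matrix, and the linear factors
  of that polynomial are removed one by one. A factor whose root is not in the disc is injective
  and can be cancelled; a factor with a root \<open>\<mu>\<close> inside turns the orbit into a solution of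
  \<open>x(k+1) = \<mu> x(k) + d(k)\<close> with \<open>d\<close> tending to 0.

  For the second claim, write \<open>u\<^sub>i = K\<^sub>i x + K\<^sub>i e\<^sub>i\<close>. The plant is then
  \<open>x(k+1) = (A + B K) x(k) + d(k)\<close> with \<open>d\<close> linear in the errors, hence tending to 0. A vanishing
  disturbance cannot destroy convergence of a linear iteration
  (\<open>perturbed_iteration_tendsto_0\<close>), so it remains to treat full state feedback. There the
  Riccati equation says that \<open>V(x) = x \<bullet> P x\<close> drops along the closed loop by the stage cost
  \<open>x \<bullet> Q x + u \<bullet> R u\<close> (\<open>riccati_energy_balance\<close>). If the cost vanishes over a long enough
  window, then the control vanishes on it, the trajectory is one of the free system, and
  observability forces it to be 0. By compactness of the unit sphere the cost over a window
  therefore dominates \<open>c \<parallel>x\<parallel>\<^sup>2\<close>, whereas the costs over later and later windows tend to 0 because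
  \<open>V\<close> decreases and is bounded below (\<open>iteration_tendsto_0_if_detectable_dissipation\<close>).
\<close>

section \<open>Linear recurrences with a vanishing disturbance\<close>

text \<open>
  Along each residue class modulo \<open>m\<close> the sequence contracts towards the fixed point of
  \<open>t \<mapsto> r t + h\<close>, where \<open>h\<close> bounds the tail of the disturbance. Lags \<open>m > 1\<close> are needed
  because a matrix with powers tending to 0 may well have norm larger than 1; only some power of
  it is a contraction.
\<close>

lemma contractive_recurrence_tendsto_0:
  fixes a d :: "nat \<Rightarrow> real"
  assumes nonneg: "\<And>k. 0 \<le> a k" and r: "0 \<le> r" "r < 1" and m: "0 < m"
    and step: "\<And>k. a (k + m) \<le> r * a k + d k" and d: "d \<longlonglongrightarrow> 0"
  shows "a \<longlonglongrightarrow> 0"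
proof (rule LIMSEQ_I)
  fix e :: real assume e: "0 < e"
  \<comment> \<open>The disturbance level for which the fixed point of \<open>t \<mapsto> r t + h\<close> is \<open>e / 2\<close>.\<close>
  define h where "h = (1 - r) * (e / 2)"
  have "0 < h" using e r by (simp add: h_def)
  then have "\<forall>\<^sub>F k in sequentially. d k < h"
    using d order_tendstoD(2) by blast
  then obtain N where N: "\<And>k. N \<le> k \<Longrightarrow> d k < h"
    by (auto simp: eventually_sequentially)
  define C where "C = (\<Sum>i<m. a (N + i))"
  have C: "a (N + i) \<le> C" if "i < m" for i
    unfolding C_def using that nonneg by (intro member_le_sum) auto
  have bound: "a (N + i + j * m) \<le> r ^ j * C + e / 2" if "i < m" for i j
  proof (induction j)
    case 0
    then show ?case using C[OF that] e by simp
  next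
    case (Suc j)
    have "a (N + i + Suc j * m) = a (N + i + j * m + m)" by (simp add: ac_simps)
    also have "\<dots> \<le> r * a (N + i + j * m) + d (N + i + j * m)" by (rule step)
    also have "\<dots> \<le> r * (r ^ j * C + e / 2) + h"
      using Suc r N[of "N + i + j * m"] by (intro add_mono mult_left_mono) auto
    also have "\<dots> = r ^ Suc j * C + e / 2" by (simp add: h_def field_simps)
    finally show ?case .
  qed
  have "(\<lambda>j. r ^ j * C) \<longlonglongrightarrow> 0 * C"
    using r by (intro tendsto_mult LIMSEQ_power_zero tendsto_const) auto
  then have "\<forall>\<^sub>F j in sequentially. r ^ j * C < e / 2"
    using e order_tendstoD(2)[of "\<lambda>j. r ^ j * C" 0 sequentially "e / 2"] by simp
  then obtain J where J: "\<And>j. J \<le> j \<Longrightarrow> r ^ j * C < e / 2"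
    by (auto simp: eventually_sequentially)
  have "norm (a k - 0) < e" if k: "N + J * m \<le> k" for k
  proof -
    define i j where "i = (k - N) mod m" and "j = (k - N) div m"
    have kij: "k = N + i + j * m" using k by (simp add: i_def j_def)
    have "J \<le> j" unfolding j_def using k m by (simp add: less_eq_div_iff_mult_less_eq)
    then have "r ^ j * C < e / 2" by (rule J)
    moreover have "a k \<le> r ^ j * C + e / 2"
      unfolding kij using m by (intro bound) (simp add: i_def)
    ultimately show ?thesis using nonneg[of k] by simp
  qed
  then show "\<exists>no. \<forall>k\<ge>no. norm (a k - 0) < e" by blast
qed

lemma linear_funpow:
  fixes f :: "'a::real_vector \<Rightarrow> 'a"
  assumes "linear f"
  shows "linear (f ^^ k)"
proof (induction k)
  case 0
  show ?case unfolding funpow.simps(1) by (rule linear_id)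
next
  case (Suc k)
  show ?case unfolding funpow.simps(2) by (rule linear_compose[OF Suc assms])
qed

text \<open>
  Convergence on a basis is uniform on the unit ball, so some power \<open>f\<^sup>m\<close> halves all norms. Over
  \<open>m\<close> steps the disturbed trajectory differs from the undisturbed one by finitely many
  propagated disturbances, which vanish in the limit.
\<close>

lemma perturbed_iteration_tendsto_0:
  fixes f :: "'a::euclidean_space \<Rightarrow> 'a"
  assumes "linear f" and powers: "\<And>v. (\<lambda>k. (f ^^ k) v) \<longlonglongrightarrow> 0"
    and x: "\<And>k. x (Suc k) = f (x k) + d k" and d: "d \<longlonglongrightarrow> 0"
  shows "x \<longlonglongrightarrow> 0"
proof -
  have "(\<lambda>k. \<Sum>b\<in>Basis. norm ((f ^^ k) b)) \<longlonglongrightarrow> (\<Sum>b\<in>(Basis::'a set). 0)"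
    by (intro tendsto_sum tendsto_norm_zero powers)
  then have "\<forall>\<^sub>F k in sequentially. (\<Sum>b\<in>Basis. norm ((f ^^ k) b)) < 1 / 2"
    by (intro order_tendstoD(2)[where y = "0::real"]) auto
  then obtain N where N: "\<And>k. N \<le> k \<Longrightarrow> (\<Sum>b\<in>Basis. norm ((f ^^ k) b)) < 1 / 2"
    by (auto simp: eventually_sequentially)
  \<comment> \<open>The successor makes the lag positive, as the recurrence lemma demands.\<close>
  define m where "m = Suc N"
  have m: "0 < m" "(\<Sum>b\<in>Basis. norm ((f ^^ m) b)) < 1 / 2" using N[of m] by (simp_all add: m_def)
  have half: "norm ((f ^^ m) v) \<le> 1 / 2 * norm v" for v
  proof -
    have "(f ^^ m) v = (f ^^ m) (\<Sum>b\<in>Basis. (v \<bullet> b) *\<^sub>R b)" by (simp add: euclidean_representation)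
    also have "\<dots> = (\<Sum>b\<in>Basis. (v \<bullet> b) *\<^sub>R (f ^^ m) b)"
      using linear_funpow[OF \<open>linear f\<close>] by (simp add: linear_sum linear_cmul)
    also have "norm \<dots> \<le> (\<Sum>b\<in>Basis. norm v * norm ((f ^^ m) b))"
      by (rule sum_norm_le) (simp add: Basis_le_norm mult_right_mono)
    also have "\<dots> = norm v * (\<Sum>b\<in>Basis. norm ((f ^^ m) b))" by (simp add: sum_distrib_left)
    also have "\<dots> \<le> norm v * (1 / 2)" using m(2) by (intro mult_left_mono) auto
    finally show ?thesis by (simp add: mult.commute)
  qed
  have defect: "(\<lambda>k. x (k + j) - (f ^^ j) (x k)) \<longlonglongrightarrow> 0" for j
  proof (induction j)
    case (Suc j)
    have "bounded_linear f" using \<open>linear f\<close> by (simp add: linear_conv_bounded_linear)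
    then have "(\<lambda>k. f (x (k + j) - (f ^^ j) (x k)) + d (k + j)) \<longlonglongrightarrow> f 0 + 0"
      by (rule tendsto_add[OF bounded_linear.tendsto[OF _ Suc] LIMSEQ_ignore_initial_segment[OF d]])
    moreover have "x (k + Suc j) - (f ^^ Suc j) (x k) = f (x (k + j) - (f ^^ j) (x k)) + d (k + j)" for k
      using \<open>linear f\<close> by (simp add: x linear_diff)
    ultimately show ?case using \<open>linear f\<close> by (simp add: linear_0)
  qed simp
  have "norm (x (k + m)) \<le> 1 / 2 * norm (x k) + norm (x (k + m) - (f ^^ m) (x k))" for k
    using half[of "x k"] norm_triangle_sub[of "x (k + m)" "(f ^^ m) (x k)"] by linarith
  then have "(\<lambda>k. norm (x k)) \<longlonglongrightarrow> 0"
    using m(1) tendsto_norm_zero[OF defect[of m]]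
      contractive_recurrence_tendsto_0[where r = "1 / 2" and m = m,
        of "\<lambda>k. norm (x k)" "\<lambda>k. norm (x (k + m) - (f ^^ m) (x k))"] by simp
  then show ?thesis by (rule tendsto_norm_zero_cancel)
qed

section \<open>Powers of a matrix with spectrum in the open unit disc\<close>

lemma norm_vector_scalar_mult: "norm (c *s x) = norm c * norm (x :: complex^'n)"
  by (simp add: norm_vec_def norm_mult L2_set_right_distrib)

text \<open>
  The vector \<open>p(M) v\<close>.
\<close>

definition poly_act :: "complex^'n^'n \<Rightarrow> complex poly \<Rightarrow> complex^'n \<Rightarrow> complex^'n" where
  "poly_act M p v = (\<Sum>i\<le>degree p. coeff p i *s ((*v) M ^^ i) v)"

lemma poly_act_eq_sum:
  assumes "degree p \<le> n"
  shows "poly_act M p v = (\<Sum>i\<le>n. coeff p i *s ((*v) M ^^ i) v)"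
  unfolding poly_act_def using assms
  by (intro sum.mono_neutral_left) (auto simp: coeff_eq_0)

lemma funpow_linear_factor:
  "((*v) M ^^ k) (M *v v - \<mu> *s v) = ((*v) M ^^ Suc k) v - \<mu> *s ((*v) M ^^ k) (v :: complex^'n)"
  by (induction k) (auto simp: vec.diff vec.scale)

text \<open>
  Polynomials in \<open>M\<close> commute, so the factor \<open>M - \<mu>\<close> of \<open>p(M)\<close> may be applied first or last. Applied
  first, it replaces the vector by a simpler one; applied last, it exhibits \<open>q(M) v\<close> as an
  eigenvector or 0.
\<close>

lemma poly_act_linear_factor:
  "poly_act M ([:- \<mu>, 1:] * q) v = poly_act M q (M *v v - \<mu> *s v)"
proof -
  define n where "n = degree q"
  have coeff: "coeff ([:- \<mu>, 1:] * q) i = (case i of 0 \<Rightarrow> 0 | Suc j \<Rightarrow> coeff q j) - \<mu> * coeff q i" for i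
    by (simp add: coeff_pCons split: nat.split)
  have "degree ([:- \<mu>, 1:] * q) \<le> Suc n"
    using degree_mult_le[of "[:- \<mu>, 1:]" q] by (simp add: n_def)
  then have "poly_act M ([:- \<mu>, 1:] * q) v
     = (\<Sum>i\<le>Suc n. coeff ([:- \<mu>, 1:] * q) i *s ((*v) M ^^ i) v)"
    by (rule poly_act_eq_sum)
  also have "\<dots> = (\<Sum>i\<le>Suc n. (case i of 0 \<Rightarrow> 0 | Suc j \<Rightarrow> coeff q j) *s ((*v) M ^^ i) v)
      - (\<Sum>i\<le>Suc n. (\<mu> * coeff q i) *s ((*v) M ^^ i) v)"
    unfolding coeff vector_sub_rdistrib by (rule sum_subtractf)
  also have "(\<Sum>i\<le>Suc n. (case i of 0 \<Rightarrow> 0 | Suc j \<Rightarrow> coeff q j) *s ((*v) M ^^ i) v)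
      = (\<Sum>i\<le>n. coeff q i *s ((*v) M ^^ Suc i) v)"
    by (subst sum.atMost_Suc_shift) simp
  also have "(\<Sum>i\<le>Suc n. (\<mu> * coeff q i) *s ((*v) M ^^ i) v)
      = (\<Sum>i\<le>n. (\<mu> * coeff q i) *s ((*v) M ^^ i) v)"
    by (simp add: n_def coeff_eq_0)
  also have "(\<Sum>i\<le>n. coeff q i *s ((*v) M ^^ Suc i) v) - \<dots> = poly_act M q (M *v v - \<mu> *s v)"
    unfolding poly_act_def n_def[symmetric] funpow_linear_factor
    by (simp add: vector_ssub_ldistrib sum_subtractf vector_smult_assoc mult.commute)
  finally show ?thesis .
qed

lemma poly_act_linear_factor_left:
  "poly_act M ([:- \<mu>, 1:] * q) v = M *v poly_act M q v - \<mu> *s poly_act M q v"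
  unfolding poly_act_linear_factor
  by (simp add: poly_act_def funpow_linear_factor vector_ssub_ldistrib sum_subtractf vec.sum
      vec.scale vec.scale_sum_right vector_smult_assoc mult.commute)

text \<open>
  Induction on the degree. Take a root \<open>\<mu>\<close> of \<open>p\<close> and split \<open>p(M) = (M - \<mu>) q(M)\<close>. If
  \<open>norm \<mu> \<ge> 1\<close>, then \<open>\<mu>\<close> is no eigenvalue and \<open>q\<close> already annihilates \<open>v\<close>. Otherwise \<open>q\<close> annihilates
  \<open>w = (M - \<mu>) v\<close>, and the orbit of \<open>v\<close> solves a scalar contraction driven by the orbit of \<open>w\<close>.
\<close>

lemma powers_tendsto_0_if_annihilated:
  fixes M :: "complex^'n^'n"
  assumes eig: "\<And>\<mu> w. w \<noteq> 0 \<Longrightarrow> M *v w = \<mu> *s w \<Longrightarrow> norm \<mu> < 1"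
    and "p \<noteq> 0" "poly_act M p v = 0"
  shows "(\<lambda>k. ((*v) M ^^ k) v) \<longlonglongrightarrow> 0"
  using assms(2,3)
proof (induction "degree p" arbitrary: p v)
  case 0
  then obtain c where "p = [:c:]" by (metis degree_eq_zeroE)
  with 0 have "v = 0" by (simp add: poly_act_def)
  moreover have "((*v) M ^^ k) 0 = 0" for k by (induction k) auto
  ultimately show ?case by simp
next
  case (Suc n)
  have "\<not> constant (poly p)" using Suc.hyps(2) by (simp add: constant_degree)
  then obtain \<mu> where "poly p \<mu> = 0" using fundamental_theorem_of_algebra by blast
  then obtain q where q: "p = [:- \<mu>, 1:] * q" by (auto simp: poly_eq_0_iff_dvd)
  with Suc.prems have q0: "q \<noteq> 0" by auto
  then have deg: "n = degree q" using Suc.hyps(2) by (simp add: q degree_mult_eq del: mult_pCons_left)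
  show ?case
  proof (cases "norm \<mu> < 1")
    case True
    define w where "w = M *v v - \<mu> *s v"
    have "(\<lambda>k. ((*v) M ^^ k) w) \<longlonglongrightarrow> 0"
      using Suc.hyps(1)[OF deg q0] Suc.prems(2) unfolding q poly_act_linear_factor w_def by blast
    then have "(\<lambda>k. norm (((*v) M ^^ k) w)) \<longlonglongrightarrow> 0" by (rule tendsto_norm_zero)
    moreover have "norm (((*v) M ^^ (k + 1)) v)
        \<le> norm \<mu> * norm (((*v) M ^^ k) v) + norm (((*v) M ^^ k) w)" for k
    proof -
      have "((*v) M ^^ (k + 1)) v = \<mu> *s ((*v) M ^^ k) v + ((*v) M ^^ k) w"
        unfolding w_def funpow_linear_factor by simp
      then show ?thesis by (metis norm_triangle_ineq norm_vector_scalar_mult)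
    qed
    ultimately have "(\<lambda>k. norm (((*v) M ^^ k) v)) \<longlonglongrightarrow> 0"
      using True contractive_recurrence_tendsto_0[where r = "norm \<mu>" and m = 1,
          of "\<lambda>k. norm (((*v) M ^^ k) v)" "\<lambda>k. norm (((*v) M ^^ k) w)"] by simp
    then show ?thesis by (rule tendsto_norm_zero_cancel)
  next
    case False
    have "M *v poly_act M q v = \<mu> *s poly_act M q v"
      using Suc.prems(2) unfolding q poly_act_linear_factor_left by simp
    with False eig have "poly_act M q v = 0" by blast
    with Suc.hyps(1)[OF deg q0] show ?thesis by blast
  qed
qed

text \<open>
  More iterates of \<open>v\<close> than the dimension allows are linearly dependent. The count is
  made in the real dimension, so the coefficients that it yields are real.
\<close>

lemma ex_annihilating_poly:
  fixes M :: "complex^'n^'n"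
  shows "\<exists>p. p \<noteq> 0 \<and> poly_act M p v = 0"
proof -
  define g where "g i = ((*v) M ^^ i) v" for i
  define N where "N = DIM(complex^'n)"
  have scale: "complex_of_real c *s w = c *\<^sub>R w" for c and w :: "complex^'n"
    by (simp add: vec_eq_iff complex_eq_iff)
  have "\<exists>c. (\<exists>i\<le>N. c i \<noteq> (0::complex)) \<and> (\<Sum>i\<le>N. c i *s g i) = 0"
  proof (cases "inj_on g {..N}")
    case False
    \<comment> \<open>Dependence is a notion for sets, so a repeated iterate has to be treated on its own.\<close>
    then obtain i j where ij: "i \<le> N" "j \<le> N" "i \<noteq> j" "g i = g j"
      by (auto simp: inj_on_def)
    define c where "c k = (if k = i then 1 else if k = j then - 1 else (0::complex))" for k
    have "(\<Sum>k\<le>N. c k *s g k) = (\<Sum>k\<in>{i, j}. c k *s g k)"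
      using ij by (intro sum.mono_neutral_right) (auto simp: c_def)
    also have "\<dots> = 0" using ij by (simp add: c_def)
    finally show ?thesis using ij by (intro exI[of _ c]) (auto simp: c_def)
  next
    case True
    then have "card (g ` {..N}) = N + 1" by (simp add: card_image)
    then have "dependent (g ` {..N})" by (intro dependent_biggerset) (simp add: N_def)
    then obtain u where u: "\<exists>w\<in>g ` {..N}. u w \<noteq> 0" "(\<Sum>w\<in>g ` {..N}. u w *\<^sub>R w) = 0"
      by (auto simp: real_vector.dependent_finite)
    then have "(\<Sum>i\<le>N. complex_of_real (u (g i)) *s g i) = 0"
      using True by (simp add: scale sum.reindex)
    with u(1) show ?thesis
      by (intro exI[of _ "\<lambda>i. complex_of_real (u (g i))"]) auto
  qed
  then obtain c where c: "\<exists>i\<le>N. c i \<noteq> (0::complex)" "(\<Sum>i\<le>N. c i *s g i) = 0" by blast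
  define p where "p = (\<Sum>i\<le>N. monom (c i) i)"
  have coeff: "coeff p i = (if i \<le> N then c i else 0)" for i
    by (simp add: p_def coeff_sum)
  have "degree p \<le> N" by (rule degree_le) (simp add: coeff)
  then have "poly_act M p v = (\<Sum>i\<le>N. coeff p i *s g i)"
    by (simp add: poly_act_eq_sum g_def)
  then have "poly_act M p v = 0" using c(2) by (simp add: coeff)
  moreover have "p \<noteq> 0" using c(1) coeff by (metis coeff_0)
  ultimately show ?thesis by blast
qed

lemma stable_matrix_powers_tendsto_0:
  fixes M :: "real^'n^'n"
  assumes "stable_matrix M"
  shows "(\<lambda>k. ((*v) M ^^ k) v) \<longlonglongrightarrow> 0"
proof -
  define cv where "cv w = (\<chi> i. complex_of_real (w $ i))" for w :: "real^'n"
  define CM where "CM = map_matrix complex_of_real M"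
  have "cv (M *v w) = CM *v cv w" for w
    by (simp add: cv_def CM_def map_matrix_def matrix_vector_mult_def vec_eq_iff)
  then have pow: "cv (((*v) M ^^ k) v) = ((*v) CM ^^ k) (cv v)" for k
    by (induction k) auto
  obtain p where "p \<noteq> 0" "poly_act CM p (cv v) = 0" using ex_annihilating_poly by blast
  then have "(\<lambda>k. ((*v) CM ^^ k) (cv v)) \<longlonglongrightarrow> 0"
    using assms
    by (intro powers_tendsto_0_if_annihilated)
      (auto simp: CM_def stable_matrix_def complex_eigenvalue_def)
  then have "(\<lambda>k. cv (((*v) M ^^ k) v) $ i) \<longlonglongrightarrow> 0 $ i" for i
    unfolding pow by (rule tendsto_vec_nth)
  then have "(\<lambda>k. complex_of_real ((((*v) M ^^ k) v) $ i)) \<longlonglongrightarrow> complex_of_real (0 $ i)" for i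
    by (simp add: cv_def)
  then show ?thesis by (intro vec_tendstoI) (simp only: tendsto_of_real_iff)
qed

section \<open>Convergence from dissipation\<close>

lemma decreasing_sequence_differences_tendsto_0:
  fixes a :: "nat \<Rightarrow> real"
  assumes "\<And>k. a (Suc k) \<le> a k" "\<And>k. 0 \<le> a k"
  shows "(\<lambda>k. a k - a (k + n)) \<longlonglongrightarrow> 0"
proof -
  have "decseq a" using assms(1) by (simp add: decseq_Suc_iff)
  then obtain L where L: "a \<longlonglongrightarrow> L" using decseq_convergent[of a 0] assms(2) by blast
  have "(\<lambda>k. a k - a (k + n)) \<longlonglongrightarrow> L - L"
    by (rule tendsto_diff[OF L LIMSEQ_ignore_initial_segment[OF L]])
  then show ?thesis by simp
qed

text \<open>
  A discrete LaSalle argument in quantitative form. The loss \<open>W\<close> over a window of length \<open>N + 1\<close>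
  is positive off 0 by \<open>detect\<close>, hence at least \<open>c \<parallel>x\<parallel>\<^sup>2\<close> by compactness of the sphere and
  homogeneity. Along the orbit \<open>V\<close> decreases and is
  nonnegative, hence converges, so the losses over windows tend to 0 and with
  them the norms.
\<close>

lemma iteration_tendsto_0_if_detectable_dissipation:
  fixes f :: "'a::euclidean_space \<Rightarrow> 'a"
  assumes "linear f"
    and storage: "\<And>x. 0 \<le> V x" and dissipation: "\<And>x. 0 \<le> S x"
    and balance: "\<And>x. V x = V (f x) + S x"
    and hom: "\<And>c x. S (c *\<^sub>R x) = c\<^sup>2 * S x" and cont: "continuous_on UNIV S"
    and detect: "\<And>x. (\<forall>k\<le>N. S ((f ^^ k) x) = 0) \<Longrightarrow> x = 0"
  shows "(\<lambda>k. (f ^^ k) x) \<longlonglongrightarrow> 0"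
proof -
  note lin = linear_funpow[OF \<open>linear f\<close>]
  define W where "W x = (\<Sum>k\<le>N. S ((f ^^ k) x))" for x
  have W_hom: "W (c *\<^sub>R x) = c\<^sup>2 * W x" for c x
    by (simp add: W_def lin linear_cmul hom sum_distrib_left)
  have W_cont: "continuous_on UNIV W"
    unfolding W_def
    by (intro continuous_on_sum continuous_on_compose2[OF cont] linear_continuous_on)
      (use lin in \<open>auto simp: linear_conv_bounded_linear\<close>)
  have W_pos: "0 < W x" if "x \<noteq> 0" for x
  proof -
    have "0 \<le> W x" unfolding W_def by (intro sum_nonneg dissipation)
    moreover have "W x \<noteq> 0"
      using detect[of x] that dissipation by (auto simp: W_def sum_nonneg_eq_0_iff)
    ultimately show ?thesis by simp
  qed
  have W_V: "W x = V x - V ((f ^^ Suc N) x)" for x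
  proof -
    have "(\<Sum>k<n. S ((f ^^ k) x)) = V x - V ((f ^^ n) x)" for n
    proof (induction n)
      case (Suc n)
      then show ?case using balance[of "(f ^^ n) x"] by simp
    qed simp
    from this[of "Suc N"] show ?thesis by (simp add: W_def lessThan_Suc_atMost)
  qed
  obtain c where c: "0 < c" "\<And>x. c * (norm x)\<^sup>2 \<le> W x"
  proof -
    define U where "U = sphere (0::'a) 1"
    have "compact U" "U \<noteq> {}" by (auto simp: U_def)
    then obtain w where w: "w \<in> U" "\<And>y. y \<in> U \<Longrightarrow> W w \<le> W y"
      using continuous_attains_inf[of U W] W_cont continuous_on_subset by blast
    have "W w * (norm x)\<^sup>2 \<le> W x" for x
    proof (cases "x = 0")
      case True
      then show ?thesis using W_hom[of 0 0] by simp
    next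
      case False
      have "W x = W (norm x *\<^sub>R ((1 / norm x) *\<^sub>R x))" using False by simp
      also have "\<dots> = (norm x)\<^sup>2 * W ((1 / norm x) *\<^sub>R x)" by (rule W_hom)
      also have "\<dots> \<ge> (norm x)\<^sup>2 * W w"
        using False by (intro mult_left_mono w) (auto simp: U_def)
      finally show ?thesis by (simp add: mult.commute)
    qed
    moreover have "0 < W w" using w(1) by (intro W_pos) (auto simp: U_def)
    ultimately show ?thesis using that by blast
  qed
  have "V ((f ^^ Suc k) x) \<le> V ((f ^^ k) x)" for k
    using balance[of "(f ^^ k) x"] dissipation[of "(f ^^ k) x"] by simp
  then have losses: "(\<lambda>k. V ((f ^^ k) x) - V ((f ^^ (k + Suc N)) x)) \<longlonglongrightarrow> 0"
    by (intro decreasing_sequence_differences_tendsto_0 storage)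
  have bound: "c * (norm ((f ^^ k) x))\<^sup>2 \<le> V ((f ^^ k) x) - V ((f ^^ (k + Suc N)) x)" for k
  proof -
    have "(f ^^ (k + Suc N)) x = (f ^^ Suc N) ((f ^^ k) x)"
      unfolding add.commute[of k] funpow_add by simp
    then show ?thesis using c(2)[of "(f ^^ k) x"] W_V[of "(f ^^ k) x"] by simp
  qed
  have "(\<lambda>k. c * (norm ((f ^^ k) x))\<^sup>2) \<longlonglongrightarrow> 0"
    using bound c(1) by (intro Lim_null_comparison[OF _ losses]) simp
  then have "(\<lambda>k. (1 / c) * (c * (norm ((f ^^ k) x))\<^sup>2)) \<longlonglongrightarrow> (1 / c) * 0"
    by (intro tendsto_mult tendsto_const)
  then have "(\<lambda>k. sqrt ((norm ((f ^^ k) x))\<^sup>2)) \<longlonglongrightarrow> sqrt 0"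
    using c(1) by (intro tendsto_real_sqrt) simp
  then have "(\<lambda>k. norm ((f ^^ k) x)) \<longlonglongrightarrow> 0" by simp
  then show ?thesis by (rule tendsto_norm_zero_cancel)
qed

section \<open>Quadratic forms and block matrices\<close>

lemma inner_vector_matrix_mult:
  "x \<bullet> (y v* M) = (M *v x) \<bullet> (y :: real^'m)"
  by (metis dot_lmul_matrix inner_commute)

lemma inner_symmetric_matrix:
  assumes "transpose M = (M :: real^'n^'n)"
  shows "x \<bullet> (M *v y) = y \<bullet> (M *v x)"
  using assms by (metis inner_vector_matrix_mult transpose_matrix_vector inner_commute)

text \<open>
  Moving from \<open>x\<close> a short way in the direction \<open>- M x\<close> would make the form negative: it
  decreases to first order by \<open>2 t \<parallel>M x\<parallel>\<^sup>2\<close>, against a second-order increase.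
\<close>

lemma psd_quadratic_form_zero:
  assumes "sym_pos_semidef M" "x \<bullet> (M *v x) = 0"
  shows "M *v x = 0"
proof (rule ccontr)
  define y where "y = M *v x"
  assume "M *v x \<noteq> 0"
  then have y: "0 < y \<bullet> y" by (simp add: y_def)
  define b where "b = y \<bullet> (M *v y)"
  have b: "0 \<le> b" using assms(1) by (simp add: b_def sym_pos_semidef_def)
  have sym: "x \<bullet> (M *v y) = y \<bullet> y"
    using inner_symmetric_matrix[of M x y] assms(1) by (simp add: y_def sym_pos_semidef_def)
  \<comment> \<open>A step so short that the second-order term is at most half the first-order one; adding 1 to \<open>b\<close> covers the case \<open>b = 0\<close>.\<close>
  define t where "t = (y \<bullet> y) / (b + 1)"
  have "0 \<le> (x - t *\<^sub>R y) \<bullet> (M *v (x - t *\<^sub>R y))"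
    using assms(1) by (simp add: sym_pos_semidef_def)
  also have "\<dots> = t\<^sup>2 * b - 2 * t * (y \<bullet> y)"
    using assms(2) sym
    by (simp add: matrix_vector_mult_diff_distrib matrix_vector_mult_scaleR inner_diff y_def[symmetric]
        b_def[symmetric] power2_eq_square algebra_simps inner_commute)
  also have "\<dots> = t * (t * b - 2 * (y \<bullet> y))" by (simp add: power2_eq_square algebra_simps)
  finally have "0 \<le> t * (t * b - 2 * (y \<bullet> y))" .
  moreover have "0 < t" using y b by (simp add: t_def)
  moreover have "t * b \<le> y \<bullet> y" using y b by (simp add: t_def field_simps)
  ultimately show False using y by (simp add: zero_le_mult_iff)
qed

lemma sym_pos_def_matrix_inv:
  assumes "sym_pos_def M"
  shows "M ** matrix_inv M = mat 1"
proof -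
  have "x = 0" if "M *v x = 0" for x
    using assms that by (metis inner_zero_right less_irrefl sym_pos_def_def)
  then have "invertible M"
    by (metis invertible_left_inverse matrix_left_invertible_ker)
  then show ?thesis
    unfolding matrix_inv_def invertible_def by (metis (mono_tags, lifting) someI_ex)
qed

definition block_vector :: "'a^'m \<Rightarrow> 'a^'n \<Rightarrow> 'a^('m::finite + 'n::finite)" where
  "block_vector u w = (\<chi> i. case i of Inl a \<Rightarrow> u $ a | Inr b \<Rightarrow> w $ b)"

lemma sum_UNIV_sum_type:
  "(\<Sum>i\<in>(UNIV :: ('a::finite + 'b::finite) set). g i) = (\<Sum>i\<in>UNIV. g (Inl i)) + (\<Sum>i\<in>UNIV. g (Inr i))"
  by (simp add: UNIV_Plus_UNIV [symmetric] sum.Plus del: UNIV_Plus_UNIV)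

lemma minus_matrix_vector_mult: "(- M) *v x = - (M *v (x :: 'a::ring_1^'n))"
  by (simp add: vec_eq_iff matrix_vector_mult_def sum_negf)

lemma block_matrix_mult_block_vector:
  fixes M11 :: "'a::semiring_1^'c1^'r1" and M22 :: "'a^'c2^'r2"
  shows "block_matrix M11 M12 M21 M22 *v block_vector u w
    = block_vector (M11 *v u + M12 *v w) (M21 *v u + M22 *v w)"
  by (simp add: vec_eq_iff matrix_vector_mult_def block_matrix_def block_vector_def
      sum_UNIV_sum_type split: sum.split)

lemma block_row_mult:
  fixes M1 :: "'a::semiring_1^'c1^'r" and M2 :: "'a^'c2^'r"
  shows "block_row M1 M2 *v (N *v x) = M1 *v (first_rows N *v x) + M2 *v (last_rows N *v x)"
  by (simp add: vec_eq_iff matrix_vector_mult_def block_row_def first_rows_def last_rows_def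
      sum_UNIV_sum_type)

lemma inner_block_vector:
  "block_vector u w \<bullet> block_vector u' w' = u \<bullet> u' + w \<bullet> (w' :: real^'n)"
  by (simp add: inner_vec_def block_vector_def sum_UNIV_sum_type)

lemma block_vector_cases:
  obtains u w where "v = block_vector u w"
proof
  show "v = block_vector (\<chi> a. v $ Inl a) (\<chi> b. v $ Inr b)"
    by (simp add: vec_eq_iff block_vector_def split: sum.split)
qed

lemma sym_pos_def_block_diag:
  assumes "sym_pos_def R1" "sym_pos_def R2"
  shows "sym_pos_def (block_diag R1 R2)"
  unfolding sym_pos_def_def
proof (intro conjI allI impI)
  have "R1 $ i $ j = R1 $ j $ i" "R2 $ k $ l = R2 $ l $ k" for i j k l
    using assms by (simp_all add: sym_pos_def_def transpose_def vec_eq_iff)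
  then show "transpose (block_diag R1 R2) = block_diag R1 R2"
    by (simp add: vec_eq_iff transpose_def block_diag_def block_matrix_def split: sum.split)
next
  fix v :: "real^('a + 'b)" assume "v \<noteq> 0"
  obtain u w where v: "v = block_vector u w" by (rule block_vector_cases)
  have nonneg: "0 \<le> x \<bullet> (M *v x)" if "sym_pos_def M" for M :: "real^'c^'c" and x
    using that by (cases "x = 0") (auto simp: sym_pos_def_def less_imp_le)
  have "block_vector 0 0 = (0 :: real^('a + 'b))"
    by (simp add: vec_eq_iff block_vector_def split: sum.split)
  then have "u \<noteq> 0 \<or> w \<noteq> 0" using \<open>v \<noteq> 0\<close> by (auto simp: v)
  then have "0 < u \<bullet> (R1 *v u) + w \<bullet> (R2 *v w)"
    using assms nonneg[of R1 u] nonneg[of R2 w]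
    by (auto simp: sym_pos_def_def intro: add_pos_nonneg add_nonneg_pos)
  then show "0 < v \<bullet> (block_diag R1 R2 *v v)"
    by (simp add: v block_diag_def block_matrix_mult_block_vector inner_block_vector)
qed

section \<open>State feedback from the Riccati equation\<close>

text \<open>
  With \<open>S = R + B' P B\<close> the gain satisfies \<open>S u = - B' P A x\<close>. The Riccati equation gives
  \<open>x \<bullet> P x = (A x) \<bullet> P (A x) + x \<bullet> Q x - u \<bullet> S u\<close>. The cross terms in the expansion of
  \<open>(A x + B u) \<bullet> P (A x + B u)\<close> amount to \<open>- 2 (u \<bullet> S u)\<close>, and
  \<open>u \<bullet> S u = u \<bullet> R u + (B u) \<bullet> P (B u)\<close>, so completing the square leaves exactly \<open>u \<bullet> R u\<close>.
\<close>

lemma riccati_energy_balance: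
  fixes A P Q :: "real^'n^'n" and B :: "real^'m^'n"
  assumes P: "sym_pos_semidef P" and R: "sym_pos_def R" and "riccati_equation A B Q R P"
    and u: "u = riccati_gain A B R P *v x"
  shows "x \<bullet> (P *v x)
    = (A *v x + B *v u) \<bullet> (P *v (A *v x + B *v u)) + (x \<bullet> (Q *v x) + u \<bullet> (R *v u))"
proof -
  define S where "S = R + transpose B ** P ** B"
  define g where "g = transpose B *v (P *v (A *v x))"
  have Pt: "transpose P = P" and P0: "\<And>y. 0 \<le> y \<bullet> (P *v y)"
    using P by (auto simp: sym_pos_semidef_def)
  have quad: "w \<bullet> (S *v v) = w \<bullet> (R *v v) + (B *v w) \<bullet> (P *v (B *v v))" for v w
    by (simp add: S_def matrix_vector_mult_add_rdistrib inner_add_right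
        inner_vector_matrix_mult flip: matrix_vector_mul_assoc)
  have "sym_pos_def S"
    unfolding sym_pos_def_def
  proof (intro conjI allI impI)
    have "transpose (X + Y) = transpose X + transpose Y" for X Y :: "real^'m^'m"
      by (simp add: transpose_def vec_eq_iff)
    then show "transpose S = S"
      using R by (simp add: S_def Pt matrix_transpose_mul matrix_mul_assoc sym_pos_def_def)
  next
    fix v :: "real^'m" assume "v \<noteq> 0"
    then show "0 < v \<bullet> (S *v v)"
      using R P0[of "B *v v"] by (simp add: quad sym_pos_def_def add_pos_nonneg)
  qed
  have u_inv: "u = - (matrix_inv S *v g)"
    by (simp add: u riccati_gain_def S_def g_def minus_matrix_vector_mult flip: matrix_vector_mul_assoc)
  have Su: "S *v u = - g"
    using sym_pos_def_matrix_inv[OF \<open>sym_pos_def S\<close>]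
    by (simp add: u_inv vec.neg matrix_vector_mul_assoc)
  have "x \<bullet> (P *v x) = x \<bullet> ((transpose A ** P ** A + Q
     - transpose A ** P ** B ** matrix_inv S ** transpose B ** P ** A) *v x)"
    using assms(3) by (simp add: riccati_equation_def S_def)
  also have "\<dots> = (A *v x) \<bullet> (P *v (A *v x)) + x \<bullet> (Q *v x)
      + (A *v x) \<bullet> (P *v (B *v u))"
    by (simp add: u_inv g_def matrix_vector_mult_add_rdistrib matrix_vector_mult_diff_rdistrib
       inner_add_right inner_diff_right inner_vector_matrix_mult vec.neg flip: matrix_vector_mul_assoc)
  finally have "x \<bullet> (P *v x) = (A *v x) \<bullet> (P *v (A *v x)) + x \<bullet> (Q *v x)
      + (A *v x) \<bullet> (P *v (B *v u))" .
  moreover have "(A *v x) \<bullet> (P *v (B *v u)) = u \<bullet> g"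
    using inner_symmetric_matrix[OF Pt, of "A *v x" "B *v u"]
    by (simp add: g_def inner_vector_matrix_mult)
  moreover have "(B *v u) \<bullet> (P *v (A *v x)) = u \<bullet> g"
    by (simp add: g_def inner_vector_matrix_mult)
  moreover have "u \<bullet> (R *v u) + (B *v u) \<bullet> (P *v (B *v u)) = - (u \<bullet> g)"
    using quad[of u u] by (simp add: Su)
  ultimately show ?thesis
    by (simp add: matrix_vector_right_distrib inner_add_left inner_add_right)
qed

text \<open>
  The value function \<open>x \<bullet> P x\<close> is the storage and the stage cost is the loss. A trajectory without
  loss has zero control, because \<open>R\<close> is definite, and zero output \<open>Q x\<close>, because \<open>Q\<close> is
  semidefinite; so it is a free trajectory that cannot be told apart from 0.
\<close>

lemma riccati_closed_loop_tendsto_0: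
  fixes A P Q :: "real^'n^'n" and B :: "real^'m^'n"
  assumes P: "sym_pos_semidef P" and Q: "sym_pos_semidef Q" and R: "sym_pos_def R"
    and riccati: "riccati_equation A B Q R P" and K: "K = riccati_gain A B R P"
    and obs: "observable A Q"
  shows "(\<lambda>k. ((\<lambda>x. A *v x + B *v (K *v x)) ^^ k) x) \<longlonglongrightarrow> 0"
proof -
  define f where "f x = A *v x + B *v (K *v x)" for x
  define S where "S x = x \<bullet> (Q *v x) + (K *v x) \<bullet> (R *v (K *v x))" for x
  obtain N where N: "\<And>x z. (\<forall>k\<le>N. Q *v (((*v) A ^^ k) x) = Q *v (((*v) A ^^ k) z)) \<Longrightarrow> x = z"
    using obs unfolding observable_def by blast
  have Q0: "0 \<le> y \<bullet> (Q *v y)" for y using Q by (simp add: sym_pos_semidef_def)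
  have Rpos: "v \<noteq> 0 \<Longrightarrow> 0 < v \<bullet> (R *v v)" for v using R by (simp add: sym_pos_def_def)
  then have R0: "0 \<le> v \<bullet> (R *v v)" for v by (cases "v = 0") (auto simp: less_imp_le)
  have "(\<lambda>k. (f ^^ k) x) \<longlonglongrightarrow> 0"
  proof (rule iteration_tendsto_0_if_detectable_dissipation)
    show "linear f"
      unfolding f_def by (intro linear_compose_add matrix_vector_mul_linear)
        (simp add: matrix_vector_mul_assoc)
    show "0 \<le> x \<bullet> (P *v x)" for x using P by (simp add: sym_pos_semidef_def)
    show "0 \<le> S x" for x unfolding S_def by (intro add_nonneg_nonneg Q0 R0)
    show "x \<bullet> (P *v x) = f x \<bullet> (P *v f x) + S x" for x
      unfolding f_def S_def using riccati_energy_balance[OF P R riccati] K by blast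
    show "S (c *\<^sub>R x) = c\<^sup>2 * S x" for c x
      by (simp add: S_def matrix_vector_mult_scaleR power2_eq_square algebra_simps)
    show "continuous_on UNIV S"
      unfolding S_def matrix_vector_mul_assoc by (intro continuous_intros)
    show "x = 0" if no_loss: "\<forall>k\<le>N. S ((f ^^ k) x) = 0" for x
    proof (rule N)
      have zero: "Q *v y = 0 \<and> K *v y = 0" if "S y = 0" for y
      proof -
        have "y \<bullet> (Q *v y) = 0" "(K *v y) \<bullet> (R *v (K *v y)) = 0"
          using that Q0[of y] R0[of "K *v y"] unfolding S_def by linarith+
        then show ?thesis using psd_quadratic_form_zero[OF Q] Rpos[of "K *v y"] by (metis less_irrefl)
      qed
      have "(f ^^ k) x = ((*v) A ^^ k) x" if "k \<le> N" for k
        using that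
      proof (induction k)
        case (Suc k)
        have "S ((f ^^ k) x) = 0" using no_loss Suc.prems by simp
        then have "K *v ((f ^^ k) x) = 0" using zero by blast
        then have "f ((f ^^ k) x) = A *v ((f ^^ k) x)" unfolding f_def by simp
        with Suc show ?case by simp
      qed simp
      then have "Q *v (((*v) A ^^ k) x) = 0" if "k \<le> N" for k
        using zero no_loss that by metis
      moreover have "((*v) A ^^ k) 0 = 0" for k by (induction k) auto
      ultimately show "\<forall>k\<le>N. Q *v (((*v) A ^^ k) x) = Q *v (((*v) A ^^ k) 0)"
        by simp
    qed
  qed
  then show ?thesis by (simp add: f_def[abs_def])
qed

section \<open>Observers with private information\<close>

text \<open>
  In \<open>xh1 (k + 1) - x (k + 1)\<close> the control of the first player cancels, and that of the second
  leaves \<open>B2 (K2 (xh1 - xh2))\<close>, a difference of errors; symmetrically for the second observer.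
\<close>

lemma observer_errors_tendsto_0:
  assumes stable: "stable_matrix (block_matrix
      (A + B2 ** K2 - L1 ** H1) (- (B2 ** K2))
      (- (B1 ** K1)) (A + B1 ** K1 - L2 ** H2))"
    and loop: "observer_closed_loop A B1 B2 H1 H2 K1 K2 L1 L2 x xh1 xh2"
  shows "(\<lambda>k. xh1 k - x k) \<longlonglongrightarrow> 0" "(\<lambda>k. xh2 k - x k) \<longlonglongrightarrow> 0"
proof -
  define M where "M = block_matrix
      (A + B2 ** K2 - L1 ** H1) (- (B2 ** K2))
      (- (B1 ** K1)) (A + B1 ** K1 - L2 ** H2)"
  define e where "e k = block_vector (xh1 k - x k) (xh2 k - x k)" for k
  have steps: "x (Suc k) = A *v x k + B1 *v (K1 *v xh1 k) + B2 *v (K2 *v xh2 k)"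
    "xh1 (Suc k) = A *v xh1 k + B1 *v (K1 *v xh1 k) + B2 *v (K2 *v xh1 k)
       + L1 *v (H1 *v x k - H1 *v xh1 k)"
    "xh2 (Suc k) = A *v xh2 k + B1 *v (K1 *v xh2 k) + B2 *v (K2 *v xh2 k)
       + L2 *v (H2 *v x k - H2 *v xh2 k)" for k
    using loop by (simp_all add: observer_closed_loop_def Let_def)
  have "e (Suc k) = M *v e k" for k
    by (simp add: steps e_def M_def block_matrix_mult_block_vector
        matrix_vector_mult_add_rdistrib matrix_vector_mult_diff_rdistrib minus_matrix_vector_mult
        matrix_vector_right_distrib matrix_vector_mult_diff_distrib algebra_simps
        flip: matrix_vector_mul_assoc)
  then have "e k = ((*v) M ^^ k) (e 0)" for k by (induction k) auto
  then have "e = (\<lambda>k. ((*v) M ^^ k) (e 0))" by blast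
  then have e: "e \<longlonglongrightarrow> 0"
    using stable_matrix_powers_tendsto_0[OF stable, folded M_def] by metis
  show "(\<lambda>k. xh1 k - x k) \<longlonglongrightarrow> 0"
    using tendsto_vec_nth[OF e, of "Inl _"] by (intro vec_tendstoI) (simp add: e_def block_vector_def)
  show "(\<lambda>k. xh2 k - x k) \<longlonglongrightarrow> 0"
    using tendsto_vec_nth[OF e, of "Inr _"] by (intro vec_tendstoI) (simp add: e_def block_vector_def)
qed

theorem theorem3:
  fixes A Q P :: "real^'n^'n"
    and B1 :: "real^'m1^'n" and B2 :: "real^'m2^'n"
    and B :: "real^('m1 + 'm2)^'n"
    and R1 :: "real^'m1^'m1" and R2 :: "real^'m2^'m2"
    and R :: "real^('m1 + 'm2)^('m1 + 'm2)"
    and H1 :: "real^'n^'s1" and H2 :: "real^'n^'s2"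
    and K :: "real^'n^('m1 + 'm2)"
    and K1 :: "real^'n^'m1" and K2 :: "real^'n^'m2"
    and L1 :: "real^'s1^'n" and L2 :: "real^'s2^'n"
  assumes B: "B = block_row B1 B2"
    and R: "R = block_diag R1 R2"
    and Q: "sym_pos_semidef Q"
    and R1: "sym_pos_def R1"
    and R2: "sym_pos_def R2"
    and P: "sym_pos_semidef P"
    and riccati: "riccati_equation A B Q R P"
    and K: "K = riccati_gain A B R P"
    and K1: "K1 = first_rows K"
    and K2: "K2 = last_rows K"
    and stable: "stable_matrix (block_matrix
      (A + B2 ** K2 - L1 ** H1) (- (B2 ** K2))
      (- (B1 ** K1)) (A + B1 ** K1 - L2 ** H2))"
  shows "(\<forall>x xh1 xh2. observer_closed_loop A B1 B2 H1 H2 K1 K2 L1 L2 x xh1 xh2 \<longrightarrow>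
            (\<lambda>k. norm (xh1 k - x k)) \<longlonglongrightarrow> 0 \<and> (\<lambda>k. norm (xh2 k - x k)) \<longlonglongrightarrow> 0)
       \<and> (stabilizable A B \<and> observable A Q \<longrightarrow>
            (\<forall>x xh1 xh2. observer_closed_loop A B1 B2 H1 H2 K1 K2 L1 L2 x xh1 xh2 \<longrightarrow>
               x \<longlonglongrightarrow> 0))"
proof (intro conjI impI allI)
  fix x xh1 xh2
  assume loop: "observer_closed_loop A B1 B2 H1 H2 K1 K2 L1 L2 x xh1 xh2"
  note errors = observer_errors_tendsto_0[OF stable loop]
  show "(\<lambda>k. norm (xh1 k - x k)) \<longlonglongrightarrow> 0" "(\<lambda>k. norm (xh2 k - x k)) \<longlonglongrightarrow> 0"
    using errors by (auto intro: tendsto_norm_zero)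
  assume hyps: "stabilizable A B \<and> observable A Q"
  have Rpos: "sym_pos_def R" unfolding R using R1 R2 by (rule sym_pos_def_block_diag)
  \<comment> \<open>The observers act as state feedback plus a disturbance that is linear in the errors.\<close>
  define f where "f v = A *v v + B *v (K *v v)" for v
  define d where "d k = B1 *v (K1 *v (xh1 k - x k)) + B2 *v (K2 *v (xh2 k - x k))" for k
  show "x \<longlonglongrightarrow> 0"
  proof (rule perturbed_iteration_tendsto_0)
    show "linear f"
      unfolding f_def by (intro linear_compose_add matrix_vector_mul_linear)
        (simp add: matrix_vector_mul_assoc)
    show "(\<lambda>k. (f ^^ k) v) \<longlonglongrightarrow> 0" for v
      unfolding f_def[abs_def] using P Q Rpos riccati K hyps
      by (intro riccati_closed_loop_tendsto_0) auto
    show "x (Suc k) = f (x k) + d k" for k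
      using loop
      by (simp add: observer_closed_loop_def Let_def f_def d_def B K1 K2 block_row_mult
          matrix_vector_mult_diff_distrib algebra_simps)
    note tendsto_mult_vector = bounded_linear.tendsto[OF matrix_vector_mul_bounded_linear]
    have "d \<longlonglongrightarrow> B1 *v (K1 *v 0) + B2 *v (K2 *v 0)"
      unfolding d_def by (rule tendsto_add; intro tendsto_mult_vector errors)
    then show "d \<longlonglongrightarrow> 0" by simp
  qed
qed

end
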